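(* Let $d\ge 1$. Every almost symmetric generalized numerical semigroup $S\subseteq\mathbb{N}_0^d$ is a Frobenius generalized numerical semigroup. In particular, if $S$ is an almost symmetric generalized numerical semigroup with Frobenius element $\mathbf{f}$, genus $g$ and type $t$, then $2g+1-t= |\mathbf{f}+\mathbf{1}|_\times$.
   Context: $\mathbb{N}_0$ is the set of nonnegative integers. A generalized numerical semigroup (GNS) is a submonoid $S$ of $(\mathbb{N}_0^d,+)$ (closed under addition, containing $\mathbf{0}$) whose complement $\operatorname{H}(S)=\mathbb{N}_0^d\setminus S$ (the set of gaps) is finite. Its genus is $\operatorname{g}(S)=|\operatorname{H}(S)|$. Put $S^*=S\setminus\{\mathbf{0}\}$. The set of pseudo-Frobenius elements is $\operatorname{PF}(S)=\{\mathbf{h}\in\operatorname{H}(S)\mid \mathbf{h}+\mathbf{s}\in S\text{ for all }\mathbf{s}\in S^*\}$, and the type of $S$ is $\operatorname{t}(S)=|\operatorname{PF}(S)|$. For $\mathbf{x}=(x^{(1)},\dots,x^{(d)})\in\mathbb{N}_0^d$, $|\mathbf{x}|_\times=x^{(1)}\cdots x^{(d)}$, and $\mathbf{x}+\mathbf{1}$ is the vector with components $x^{(i)}+1$. The symbol $\le$ denotes the componentwise partial order. $S$ is a Frobenius GNS if $\operatorname{H}(S)$ has a unique maximal element with respect to $\le$; this element is called the Frobenius element of $S$. $S$ is almost symmetric if $2\operatorname{g}(S)+1-\operatorname{t}(S)=|\mathbf{h}+\mathbf{1}|_\times$ for some $\mathbf{h}\in\operatorname{H}(S)$. *)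

theory Defs
  imports "HOL-Analysis.Analysis"
begin

text \<open>
  Elements of $\mathbb{N}_0^d$ are vectors of type \<^typ>\<open>nat ^ 'd\<close> with \<open>d = CARD('d)\<close>,
  which is at least 1. Addition, \<open>0\<close>, the all-ones vector \<open>1\<close> and \<open>\<le>\<close> are the
  componentwise library ones.
\<close>

definition gaps :: "(nat ^ 'd) set \<Rightarrow> (nat ^ 'd) set" where
  "gaps S = UNIV - S"

definition gns :: "(nat ^ 'd) set \<Rightarrow> bool" where
  "gns S \<longleftrightarrow> 0 \<in> S \<and> (\<forall>x\<in>S. \<forall>y\<in>S. x + y \<in> S) \<and> finite (gaps S)"

definition genus :: "(nat ^ 'd) set \<Rightarrow> nat" where
  "genus S = card (gaps S)"

definition pseudo_frobenius :: "(nat ^ 'd) set \<Rightarrow> (nat ^ 'd) set" where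
  "pseudo_frobenius S = {h \<in> gaps S. \<forall>s \<in> S - {0}. h + s \<in> S}"

definition gns_type :: "(nat ^ 'd) set \<Rightarrow> nat" where
  "gns_type S = card (pseudo_frobenius S)"

definition vprod :: "nat ^ 'd \<Rightarrow> nat" where
  "vprod x = (\<Prod>i\<in>UNIV. x $ i)"

definition maximal_gap :: "(nat ^ 'd) set \<Rightarrow> nat ^ 'd \<Rightarrow> bool" where
  "maximal_gap S f \<longleftrightarrow> f \<in> gaps S \<and> (\<forall>h\<in>gaps S. f \<le> h \<longrightarrow> h = f)"

definition frobenius_gns :: "(nat ^ 'd) set \<Rightarrow> bool" where
  "frobenius_gns S \<longleftrightarrow> gns S \<and> (\<exists>!f. maximal_gap S f)"

text \<open>Only meaningful when \<^term>\<open>frobenius_gns S\<close> holds.\<close>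

definition frobenius_element :: "(nat ^ 'd) set \<Rightarrow> nat ^ 'd" where
  "frobenius_element S = (THE f. maximal_gap S f)"

text \<open>The equation is stated over the integers to avoid truncated subtraction.\<close>

definition almost_symmetric :: "(nat ^ 'd) set \<Rightarrow> bool" where
  "almost_symmetric S \<longleftrightarrow> gns S \<and>
     (\<exists>h\<in>gaps S. 2 * int (genus S) + 1 - int (gns_type S) = int (vprod (h + 1)))"

end

theory Submission
  imports Defs
begin

text \<open>
  For a gap \<open>h\<close>, the box of vectors below \<open>h\<close> has \<^term>\<open>vprod (h + 1)\<close> elements. The
  reflection \<open>s \<mapsto> h - s\<close> sends the elements of \<open>S\<close> in this box to gaps, since the two
  summands of a gap cannot both lie in \<open>S\<close>. Moreover the equation \<open>(h - s) + s = h\<close> says that for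
  \<open>s \<noteq> 0\<close> the gap \<open>h - s\<close> is not pseudo-Frobenius. So at most \<open>g - t + 1\<close> elements of the
  box lie in \<open>S\<close>, the additional one accounting for \<open>s = 0\<close>, and \<^term>\<open>vprod (h + 1)\<close> is at
  most \<open>2 * g + 1 - t\<close>. In this estimate the gaps of the box were counted as at most \<open>g\<close>; hence
  equality forces every gap to lie in the box. The gap that witnesses almost symmetry is thus the
  greatest gap, which makes it the Frobenius element.
\<close>

lemma finite_card_vec_atMost:
  fixes h :: "nat ^ 'd"
  shows "finite {..h}" and "card {..h} = vprod (h + 1)"
proof -
  have bij: "bij_betw vec_nth {..h} (PiE UNIV (\<lambda>i. {..h $ i}))"
    by (rule bij_betw_byWitness[where f' = vec_lambda]) (auto simp: less_eq_vec_def PiE_iff)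
  have fin: "finite (PiE (UNIV :: 'd set) (\<lambda>i. {..h $ i}))"
    by (intro finite_PiE) auto
  show "finite {..h}"
    using bij_betw_finite[OF bij] fin by blast
  have "card {..h} = card (PiE (UNIV :: 'd set) (\<lambda>i. {..h $ i}))"
    by (rule bij_betw_same_card[OF bij])
  then show "card {..h} = vprod (h + 1)"
    by (simp add: card_PiE vprod_def)
qed

lemma vec_diff_add_cancel:
  fixes x h :: "nat ^ 'd"
  assumes "x \<le> h"
  shows "h - x + x = h"
  using assms by (simp add: vec_eq_iff less_eq_vec_def)

text \<open>
  The reflection \<open>s \<mapsto> h - s\<close> is the injection behind this bound; only \<open>s = 0\<close>, whose image is
  \<open>h\<close> itself, can hit a pseudo-Frobenius element.
\<close>

lemma card_semigroup_below_gap_le: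
  fixes S :: "(nat ^ 'd) set"
  assumes "gns S" and "h \<in> gaps S"
  shows "card (S \<inter> {..h}) + gns_type S \<le> genus S + 1"
proof -
  let ?G = "gaps S" and ?P = "pseudo_frobenius S"
  have fin: "finite ?G"
    using assms(1) by (simp add: gns_def)
  have sub: "?P \<subseteq> ?G"
    by (auto simp: pseudo_frobenius_def)
  have inj: "inj_on (\<lambda>s. h - s) (S \<inter> {..h})"
  proof (rule inj_onI)
    fix x y
    assume "x \<in> S \<inter> {..h}" "y \<in> S \<inter> {..h}" and eq: "h - x = h - y"
    then have "h - y + x = h - y + y"
      using vec_diff_add_cancel[of x h] vec_diff_add_cancel[of y h] by auto
    then show "x = y"
      by simp
  qed
  have img: "(\<lambda>s. h - s) ` (S \<inter> {..h}) \<subseteq> insert h (?G - ?P)"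
  proof (rule image_subsetI)
    fix s
    assume s: "s \<in> S \<inter> {..h}"
    then have sum: "h - s + s = h"
      by (simp add: vec_diff_add_cancel)
    show "h - s \<in> insert h (?G - ?P)"
    proof (cases "s = 0")
      case True
      then show ?thesis
        using sum by simp
    next
      case False
      have "h - s \<notin> S"
      proof
        assume "h - s \<in> S"
        then have "h - s + s \<in> S"
          using s assms(1) by (auto simp: gns_def)
        then show False
          using sum assms(2) by (simp add: gaps_def)
      qed
      moreover have "h - s \<notin> ?P"
      proof
        assume "h - s \<in> ?P"
        then have "h - s + s \<in> S"
          using s False by (auto simp: pseudo_frobenius_def)
        then show False
          using sum assms(2) by (simp add: gaps_def)
      qed
      ultimately show ?thesis
        by (simp add: gaps_def)
    qed
  qed
  have "card (S \<inter> {..h}) \<le> card (insert h (?G - ?P))"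
    using card_inj_on_le[OF inj img] fin by simp
  also have "\<dots> \<le> card (?G - ?P) + 1"
    using fin by (simp add: card_insert_if)
  also have "card (?G - ?P) = card ?G - card ?P"
    using sub fin by (meson card_Diff_subset finite_subset)
  finally show ?thesis
    using card_mono[OF fin sub] by (simp add: genus_def gns_type_def)
qed

text \<open>
  The box below \<open>h\<close> contains \<^term>\<open>vprod (h + 1)\<close> vectors, so the assumption together with the
  preceding bound leaves room for no gap outside the box.
\<close>

lemma gaps_le_if_vprod_eq:
  fixes S :: "(nat ^ 'd) set"
  assumes "gns S" and "h \<in> gaps S"
    and eq: "2 * int (genus S) + 1 - int (gns_type S) = int (vprod (h + 1))"
  shows "gaps S \<subseteq> {..h}"
proof -
  have fin: "finite (gaps S)"
    using assms(1) by (simp add: gns_def)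
  have "{..h} = (S \<inter> {..h}) \<union> (gaps S \<inter> {..h})"
    by (auto simp: gaps_def)
  moreover have "card ((S \<inter> {..h}) \<union> (gaps S \<inter> {..h}))
      = card (S \<inter> {..h}) + card (gaps S \<inter> {..h})"
    by (intro card_Un_disjoint) (auto simp: gaps_def finite_card_vec_atMost(1))
  ultimately have "vprod (h + 1) = card (S \<inter> {..h}) + card (gaps S \<inter> {..h})"
    using finite_card_vec_atMost(2)[of h] by simp
  then have "card (gaps S) \<le> card (gaps S \<inter> {..h})"
    using card_semigroup_below_gap_le[OF assms(1,2)] eq by (simp add: genus_def)
  then have "gaps S \<inter> {..h} = gaps S"
    using fin by (intro card_seteq) auto
  then show ?thesis
    by blast
qed

theorem proposition2p14:
  fixes S :: "(nat ^ 'd) set"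
  assumes "gns S" and "almost_symmetric S"
  shows "frobenius_gns S \<and>
    2 * int (genus S) + 1 - int (gns_type S) = int (vprod (frobenius_element S + 1))"
proof -
  obtain h where h: "h \<in> gaps S"
    and eq: "2 * int (genus S) + 1 - int (gns_type S) = int (vprod (h + 1))"
    using assms(2) by (auto simp: almost_symmetric_def)
  have below: "x \<le> h" if "x \<in> gaps S" for x
    using gaps_le_if_vprod_eq[OF assms(1) h eq] that by auto
  have max: "maximal_gap S f \<longleftrightarrow> f = h" for f
    using h below by (auto simp: maximal_gap_def intro: antisym)
  then show ?thesis
    using assms(1) eq by (simp add: frobenius_gns_def frobenius_element_def)
qed

end
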